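(* Let $\mathbb{X}$ be a real Banach space. Then $\mathbb{X}$ is a Hilbert space (i.e., its norm is induced by an inner product) if and only if for every two-dimensional subspace $\mathbb{Y}$ of $\mathbb{X}$, isometries are the only extreme contractions in $\mathbb{L}(\mathbb{Y})$ (i.e., every extreme contraction $T\in\mathbb{L}(\mathbb{Y})$ is an isometry).
   Context: For a Banach space $\mathbb{Y}$, $\mathbb{L}(\mathbb{Y})$ denotes the space of bounded linear operators from $\mathbb{Y}$ to itself, with the operator norm. $T\in\mathbb{L}(\mathbb{Y})$ is a contraction if $\|T\|\le 1$, and is an extreme contraction if in addition it is an extreme point of the closed unit ball of $\mathbb{L}(\mathbb{Y})$. Subspaces $\mathbb{Y}$ of $\mathbb{X}$ carry the norm inherited from $\mathbb{X}$. An isometry in $\mathbb{L}(\mathbb{Y})$ is a linear operator $T$ with $\|Ty\|=\|y\|$ for all $y\in\mathbb{Y}$. *)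

theory Defs
  imports "HOL-Analysis.Analysis" "HOL-Library.Function_Algebras"
begin

(* Pointwise scaling; Function_Algebras already supplies the pointwise addition. This makes
   extreme_point_of applicable to sets of operators represented as functions. *)

instantiation "fun" :: (type, real_vector) real_vector
begin

definition scaleR_fun_def: "c *\<^sub>R f = (\<lambda>x. c *\<^sub>R f x)"

instance
  by standard (simp_all add: scaleR_fun_def fun_eq_iff scaleR_add_right scaleR_add_left)

end

definition is_inner_product :: "('a::real_vector \<Rightarrow> 'a \<Rightarrow> real) \<Rightarrow> bool" where
  "is_inner_product ip \<longleftrightarrow>
     bilinear ip \<and> (\<forall>x y. ip x y = ip y x) \<and> (\<forall>x. 0 \<le> ip x x) \<and> (\<forall>x. ip x x = 0 \<longleftrightarrow> x = 0)"

definition norm_from_inner_product :: "'a::real_normed_vector itself \<Rightarrow> bool" where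
  "norm_from_inner_product _ \<longleftrightarrow>
     (\<exists>ip :: 'a \<Rightarrow> 'a \<Rightarrow> real. is_inner_product ip \<and> (\<forall>x. norm x = sqrt (ip x x)))"

(* An operator on the subspace Y is represented by the function on the ambient space that
   agrees with it on Y and vanishes off Y. The last clause makes the representation unique, so
   that equality of these functions is equality of operators on Y; no linearity on the ambient
   space is required. The set is closed under the pointwise vector space operations. *)

definition bounded_operators_on :: "'a::real_normed_vector set \<Rightarrow> ('a \<Rightarrow> 'a) set" where
  "bounded_operators_on Y = {T.
     (\<forall>x\<in>Y. T x \<in> Y) \<and>
     (\<forall>x\<in>Y. \<forall>y\<in>Y. T (x + y) = T x + T y) \<and>
     (\<forall>c. \<forall>x\<in>Y. T (c *\<^sub>R x) = c *\<^sub>R T x) \<and>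
     (\<exists>K. \<forall>x\<in>Y. norm (T x) \<le> K * norm x) \<and>
     (\<forall>x. x \<notin> Y \<longrightarrow> T x = 0)}"

definition operator_norm_on :: "'a::real_normed_vector set \<Rightarrow> ('a \<Rightarrow> 'a) \<Rightarrow> real" where
  "operator_norm_on Y T = (SUP y\<in>{y \<in> Y. norm y \<le> 1}. norm (T y))"

definition operator_unit_ball :: "'a::real_normed_vector set \<Rightarrow> ('a \<Rightarrow> 'a) set" where
  "operator_unit_ball Y = {T \<in> bounded_operators_on Y. operator_norm_on Y T \<le> 1}"

definition extreme_contraction_on :: "'a::real_normed_vector set \<Rightarrow> ('a \<Rightarrow> 'a) \<Rightarrow> bool" where
  "extreme_contraction_on Y T \<longleftrightarrow>
     T \<in> bounded_operators_on Y \<and> operator_norm_on Y T \<le> 1 \<and>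
     T extreme_point_of operator_unit_ball Y"

definition linear_isometry_on :: "'a::real_normed_vector set \<Rightarrow> ('a \<Rightarrow> 'a) \<Rightarrow> bool" where
  "linear_isometry_on Y T \<longleftrightarrow> T \<in> bounded_operators_on Y \<and> (\<forall>y\<in>Y. norm (T y) = norm y)"

end

theory Submission
  imports Defs
begin

text \<open>
  In a Euclidean plane a contraction that is not an isometry can be perturbed in a direction
  orthogonal to its largest singular vector, so it is not extreme.

  Conversely, let \<open>q\<close> be the quadratic form of maximal determinant below the squared norm of a
  plane. Strict log-concavity of the determinant makes \<open>q\<close> unique, so every isometry preserves \<open>q\<close>.
  If all extreme contractions are isometries, the theorem of Krein and Milman shows that every
  contraction of the plane is also a contraction for \<open>q\<close>. By maximality, \<open>q\<close> touches the squared
  norm at some unit vector \<open>y\<close>. Applying the previous remark to the rank one contractions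
  \<open>x \<mapsto> f x \<cdot> y\<close> yields \<open>(f x)\<^sup>2 \<le> q x\<close> for all functionals \<open>f\<close> of norm at most one, that
  is, \<open>q\<close> is the squared norm. A norm that is Euclidean on all planes is induced by an inner
  product.
\<close>

declare split_paired_All [simp del] split_paired_Ex [simp del]

section \<open>Plane matrices and binary quadratic forms\<close>

text \<open>A matrix is the pair of its columns; \<open>(a, b, c)\<close> is the form \<open>a x\<^sup>2 + 2 b x y + c y\<^sup>2\<close>.\<close>

definition mat_app :: "(real \<times> real) \<times> (real \<times> real) \<Rightarrow> real \<times> real \<Rightarrow> real \<times> real" where
  "mat_app M p = fst p *\<^sub>R fst M + snd p *\<^sub>R snd M"

definition mat_det :: "(real \<times> real) \<times> (real \<times> real) \<Rightarrow> real" where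
  "mat_det M = fst (fst M) * snd (snd M) - fst (snd M) * snd (fst M)"

definition quad_form :: "real \<times> real \<times> real \<Rightarrow> real \<times> real \<Rightarrow> real" where
  "quad_form t p = fst t * (fst p)\<^sup>2 + 2 * fst (snd t) * fst p * snd p + snd (snd t) * (snd p)\<^sup>2"

definition form_det :: "real \<times> real \<times> real \<Rightarrow> real" where
  "form_det t = fst t * snd (snd t) - (fst (snd t))\<^sup>2"

text \<open>The middle entry is the polar bilinear form of \<open>t\<close> at the two columns of
  \<open>M\<close>, so this is the congruence \<open>M^T t M\<close> of symmetric matrices.\<close>

definition form_pullback ::
  "real \<times> real \<times> real \<Rightarrow> (real \<times> real) \<times> (real \<times> real) \<Rightarrow> real \<times> real \<times> real" where
  "form_pullback t M =
     (quad_form t (fst M),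
      fst t * fst (fst M) * fst (snd M) +
        fst (snd t) * (fst (fst M) * snd (snd M) + snd (fst M) * fst (snd M)) +
        snd (snd t) * snd (fst M) * snd (snd M),
      quad_form t (snd M))"

lemma quad_form_pullback: "quad_form (form_pullback t M) p = quad_form t (mat_app M p)"
  by (simp add: quad_form_def form_pullback_def mat_app_def power2_eq_square algebra_simps)

lemma form_det_pullback: "form_det (form_pullback t M) = form_det t * (mat_det M)\<^sup>2"
  by (simp add: quad_form_def form_pullback_def form_det_def mat_det_def power2_eq_square algebra_simps)

lemma quad_form_scaleR: "quad_form t (r *\<^sub>R p) = r\<^sup>2 * quad_form t p"
  by (simp add: quad_form_def power2_eq_square algebra_simps)

lemma quad_form_scaleR_form: "quad_form (r *\<^sub>R t) p = r * quad_form t p"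
  by (simp add: quad_form_def algebra_simps)

lemma quad_form_add_form: "quad_form (s + t) p = quad_form s p + quad_form t p"
  by (simp add: quad_form_def algebra_simps)

lemma form_det_scaleR: "form_det (r *\<^sub>R t) = r\<^sup>2 * form_det t"
  by (simp add: form_det_def power2_eq_square algebra_simps)

text \<open>For \<open>u + v = 1\<close> the convexity defect is exactly \<open>u * v\<close> times
  the value of the form at \<open>x - y\<close>.\<close>

lemma quad_form_convex:
  assumes "\<And>p. 0 \<le> quad_form t p" and "0 \<le> u" "0 \<le> v" "u + v = 1"
  shows "quad_form t (u *\<^sub>R x + v *\<^sub>R y) \<le> u * quad_form t x + v * quad_form t y"
proof -
  have u: "u = 1 - v" using assms by simp
  have "u * quad_form t x + v * quad_form t y - quad_form t (u *\<^sub>R x + v *\<^sub>R y)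
      = u * v * quad_form t (x - y)"
    unfolding u by (simp add: quad_form_def power2_eq_square algebra_simps)
  with assms(1)[of "x - y"] assms(2,3) show ?thesis
    by (smt (verit) mult_nonneg_nonneg)
qed

text \<open>This equality case in the log-concavity of the determinant makes a determinant maximizer
  unique among forms closed under midpoints.\<close>

lemma form_det_midpoint:
  assumes "form_det s = d" "form_det t = d" "0 < d" "0 < fst s" "0 < fst t"
    and "form_det ((1/2) *\<^sub>R (s + t)) \<le> d"
  shows "s = t"
proof -
  obtain a b c where s: "s = (a, b, c)" by (cases s) auto
  obtain a' b' c' where t: "t = (a', b', c')" by (cases t) auto
  have pos: "0 < a" "0 < a'" using assms s t by auto
  have e: "a * c - b\<^sup>2 = d" "a' * c' - b'\<^sup>2 = d" using assms s t by (auto simp: form_det_def)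
  have "(a + a') * (c + c') - (b + b')\<^sup>2 \<le> 4 * d"
    using assms(6) unfolding s t by (simp add: form_det_def power2_eq_square field_simps)
  then have "a * a' * ((a + a') * (c + c') - (b + b')\<^sup>2 - 4 * d) \<le> 0"
    using pos by (simp add: mult_nonneg_nonpos)
  \<comment> \<open>The factor \<open>a * a'\<close> permits eliminating \<open>c\<close> and
    \<open>c'\<close> through the two determinant equations. What remains is a sum of squares with
    positive weights.\<close>
  moreover have "a * a' * ((a + a') * (c + c') - (b + b')\<^sup>2 - 4 * d)
      = d * (a - a')\<^sup>2 + (a * b' - a' * b)\<^sup>2 + (a * a' + a'\<^sup>2) * (a * c - b\<^sup>2 - d)
        + (a * a' + a\<^sup>2) * (a' * c' - b'\<^sup>2 - d)"
    by (simp add: power2_eq_square algebra_simps)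
  ultimately have "d * (a - a')\<^sup>2 + (a * b' - a' * b)\<^sup>2 \<le> 0" using e by simp
  moreover have "0 \<le> d * (a - a')\<^sup>2" using \<open>0 < d\<close> by simp
  ultimately have "d * (a - a')\<^sup>2 = 0" "(a * b' - a' * b)\<^sup>2 = 0"
    by (smt (verit) zero_le_power2)+
  then have "a = a'" "a * b' = a' * b" using \<open>0 < d\<close> by auto
  then show ?thesis using pos e unfolding s t by auto
qed

section \<open>Matrices as linear maps of the plane\<close>

lemma linear_mat_app: "linear (mat_app M)"
  by (rule linearI) (simp_all add: mat_app_def algebra_simps)

lemma mat_app_add_left: "mat_app (M + M') p = mat_app M p + mat_app M' p"
  by (simp add: mat_app_def algebra_simps)

lemma mat_app_scaleR_left: "mat_app (r *\<^sub>R M) p = r *\<^sub>R mat_app M p"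
  by (simp add: mat_app_def algebra_simps)

lemma mat_app_inject: "(\<And>p. mat_app M p = mat_app M' p) \<Longrightarrow> M = M'"
proof -
  assume "\<And>p. mat_app M p = mat_app M' p"
  from this[of "(1,0)"] this[of "(0,1)"] show "M = M'"
    by (simp add: mat_app_def prod_eq_iff)
qed

lemma linear_plane_eq:
  assumes "linear (f :: real \<times> real \<Rightarrow> 'b::real_vector)"
  shows "f p = fst p *\<^sub>R f (1, 0) + snd p *\<^sub>R f (0, 1)"
proof -
  have "p = fst p *\<^sub>R (1, 0) + snd p *\<^sub>R (0, 1)" by (simp add: prod_eq_iff)
  then have "f p = f (fst p *\<^sub>R (1, 0) + snd p *\<^sub>R (0, 1))" by simp
  also have "\<dots> = fst p *\<^sub>R f (1, 0) + snd p *\<^sub>R f (0, 1)"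
    by (simp only: linear_add[OF assms] linear_scale[OF assms])
  finally show ?thesis .
qed

lemma mat_app_of_linear: "linear f \<Longrightarrow> mat_app (f (1, 0), f (0, 1)) p = f p"
  unfolding mat_app_def using linear_plane_eq[of f p] by simp

section \<open>Unit balls of operators and extreme points\<close>

text \<open>The boundedness clause keeps the supremum finite, so it can be compared pointwise on the
  unit ball. Homogeneity then carries the bound to all of \<open>Y\<close>.\<close>

lemma operator_unit_ball_iff:
  assumes "subspace Y"
  shows "T \<in> operator_unit_ball Y \<longleftrightarrow>
    T \<in> bounded_operators_on Y \<and> (\<forall>y\<in>Y. norm (T y) \<le> norm y)"
proof (cases "T \<in> bounded_operators_on Y")
  case True
  then obtain K where K: "\<And>y. y \<in> Y \<Longrightarrow> norm (T y) \<le> K * norm y"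
    and scale: "\<And>c y. y \<in> Y \<Longrightarrow> T (c *\<^sub>R y) = c *\<^sub>R T y"
    unfolding bounded_operators_on_def by blast
  have "norm (T y) \<le> \<bar>K\<bar>" if "y \<in> Y" "norm y \<le> 1" for y
  proof -
    have "K * norm y \<le> \<bar>K\<bar> * 1" using that by (intro mult_mono) auto
    with K[OF that(1)] show ?thesis by simp
  qed
  then have bdd: "bdd_above ((\<lambda>y. norm (T y)) ` {y \<in> Y. norm y \<le> 1})"
    by (intro bdd_aboveI2[where M = "\<bar>K\<bar>"]) auto
  have ne: "{y \<in> Y. norm y \<le> 1} \<noteq> {}" using subspace_0[OF assms] by auto
  have "operator_norm_on Y T \<le> 1 \<longleftrightarrow> (\<forall>y\<in>{y \<in> Y. norm y \<le> 1}. norm (T y) \<le> 1)"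
    unfolding operator_norm_on_def by (rule cSUP_le_iff[OF ne bdd])
  also have "\<dots> \<longleftrightarrow> (\<forall>y\<in>Y. norm (T y) \<le> norm y)"
  proof (intro iffI ballI)
    fix y assume *: "\<forall>y\<in>{y \<in> Y. norm y \<le> 1}. norm (T y) \<le> 1" and y: "y \<in> Y"
    show "norm (T y) \<le> norm y"
    proof (cases "y = 0")
      case True
      then show ?thesis using K[OF y] by simp
    next
      case False
      then have "norm (T ((1 / norm y) *\<^sub>R y)) \<le> 1"
        using * y subspace_scale[OF assms] by simp
      then show ?thesis using False by (simp add: scale[OF y] field_simps)
    qed
  qed force
  finally show ?thesis using True by (simp add: operator_unit_ball_def)
qed (simp add: operator_unit_ball_def)

lemma extreme_point_of_linear_image:
  assumes "linear f" "inj f"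
  shows "f x extreme_point_of (f ` S) \<longleftrightarrow> x extreme_point_of S"
  unfolding extreme_point_of_def
  by (simp add: open_segment_linear_image[OF assms] inj_image_mem_iff[OF assms(2)])

text \<open>The point \<open>x\<close> is the midpoint of the two perturbed points. Extremality will
  be refuted by exhibiting a nonzero \<open>d\<close> of this kind.\<close>

lemma extreme_point_perturbation:
  assumes "x extreme_point_of S" "x + d \<in> S" "x - d \<in> S"
  shows "d = 0"
proof (rule ccontr)
  assume "d \<noteq> 0"
  have "x = (1 - 1/2) *\<^sub>R (x + d) + (1/2) *\<^sub>R (x - d)"
    by (simp add: algebra_simps flip: scaleR_add_left)
  moreover have "x + d \<noteq> x - d"
  proof
    assume "x + d = x - d"
    then have "2 *\<^sub>R d = 0" by (simp add: scaleR_2 algebra_simps add_eq_0_iff)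
    with \<open>d \<noteq> 0\<close> show False by simp
  qed
  ultimately have "x \<in> open_segment (x + d) (x - d)"
    unfolding in_segment by (intro conjI exI[of _ "1/2"]) auto
  with assms show False by (auto simp: extreme_point_of_def)
qed

lemma norm_orthogonal_combination:
  fixes a b :: "'a::real_inner"
  assumes "a \<bullet> b = 0"
  shows "(norm (x *\<^sub>R a + y *\<^sub>R b))\<^sup>2 = x\<^sup>2 * (norm a)\<^sup>2 + y\<^sup>2 * (norm b)\<^sup>2"
proof -
  have "b \<bullet> a = 0" using assms by (simp add: inner_commute)
  with assms show ?thesis
    by (simp only: power2_norm_eq_inner inner_add_left inner_add_right inner_scaleR_left
        inner_scaleR_right) (simp add: power2_eq_square)
qed

lemma mat_app_diff_left: "mat_app (M - M') p = mat_app M p - mat_app M' p"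
  by (simp add: mat_app_def algebra_simps)

section \<open>Coordinates on a plane\<close>

text \<open>A plane in a space of any dimension is studied through coordinates, where compactness
  and the theorem of Krein and Milman for Euclidean spaces apply.\<close>

locale plane_chart =
  fixes L :: "real \<times> real \<Rightarrow> 'a::real_normed_vector"
  assumes linear_L: "linear L" and inj_L: "inj L"
begin

definition "N p = norm (L p)"

definition "contractions = {M. \<forall>p. N (mat_app M p) \<le> N p}"

lemma N_ge_0 [simp]: "0 \<le> N p" by (simp add: N_def)

lemma N_eq_0 [simp]: "N p = 0 \<longleftrightarrow> p = 0"
  unfolding N_def using linear_L inj_L by (metis injD linear_0 norm_eq_zero)

lemma N_0 [simp]: "N 0 = 0" by simp

lemma N_scaleR: "N (r *\<^sub>R p) = \<bar>r\<bar> * N p"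
  by (simp add: N_def linear_scale[OF linear_L])

lemma N_add: "N (p + q) \<le> N p + N q"
  by (simp add: N_def linear_add[OF linear_L] norm_triangle_ineq)

lemma continuous_on_N [continuous_intros]:
  fixes f :: "'b::topological_space \<Rightarrow> real \<times> real"
  assumes "continuous_on S f"
  shows "continuous_on S (\<lambda>x. N (f x))"
proof -
  have "bounded_linear L" using linear_L linear_conv_bounded_linear by blast
  from bounded_linear.continuous_on[OF this assms] show ?thesis
    unfolding N_def by (intro continuous_intros)
qed

text \<open>By compactness the minimum of \<open>N\<close> on the Euclidean unit circle is attained
  at a nonzero point. It is therefore positive and serves as \<open>m\<close>.\<close>

lemma N_lower_bound: obtains m where "0 < m" "\<And>p. m * norm p \<le> N p"
proof -
  have "compact (sphere 0 1 :: (real \<times> real) set)" "(sphere 0 1 :: (real \<times> real) set) \<noteq> {}"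
    by auto
  moreover have "continuous_on (sphere 0 1) N" using continuous_on_N[OF continuous_on_id] by simp
  ultimately have "\<exists>z \<in> sphere 0 1. \<forall>p \<in> sphere 0 1. N z \<le> N p"
    by (rule continuous_attains_inf)
  then obtain z where z: "z \<in> sphere 0 1" "\<And>p. p \<in> sphere 0 1 \<Longrightarrow> N z \<le> N p"
    by blast
  have "z \<noteq> 0" using z by auto
  then have "0 < N z" by (metis N_eq_0 N_ge_0 order_less_le)
  moreover have "N z * norm p \<le> N p" for p
  proof (cases "p = 0")
    case False
    then have "N z \<le> N ((1 / norm p) *\<^sub>R p)" by (intro z) auto
    with False show ?thesis by (simp add: N_scaleR field_simps)
  qed simp
  ultimately show ?thesis using that by blast
qed

lemma compact_N_le: "compact {p. N p \<le> r}"
proof -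
  obtain m where m: "0 < m" "\<And>p. m * norm p \<le> N p" using N_lower_bound by blast
  have "norm p \<le> r / m" if "N p \<le> r" for p
    using m that by (smt (verit) mult.commute pos_le_divide_eq)
  then have "bounded {p. N p \<le> r}" unfolding bounded_iff by blast
  moreover have "closed {p. N p \<le> r}"
    by (intro closed_Collect_le continuous_intros)
  ultimately show ?thesis by (simp add: compact_eq_bounded_closed)
qed

lemma convex_N_le: "convex {p. N p \<le> r}"
proof (rule convexI; clarsimp)
  fix x1 x2 y1 y2 u v :: real
  assume *: "N (x1, x2) \<le> r" "N (y1, y2) \<le> r" "0 \<le> u" "0 \<le> v" "u + v = 1"
  have "N (u *\<^sub>R (x1, x2) + v *\<^sub>R (y1, y2)) \<le> u * N (x1, x2) + v * N (y1, y2)"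
    using N_add[of "u *\<^sub>R (x1, x2)" "v *\<^sub>R (y1, y2)"] * by (simp only: N_scaleR abs_of_nonneg)
  also have "\<dots> \<le> u * r + v * r" using * by (intro add_mono mult_left_mono) auto
  also have "\<dots> = r" using * by (simp flip: distrib_right)
  finally show "N (u * x1 + v * y1, u * x2 + v * y2) \<le> r" by simp
qed

lemma compact_contractions: "compact contractions"
proof -
  \<comment> \<open>The columns are the images of the basis vectors, so for a contraction they lie
    in two fixed balls of \<open>N\<close>.\<close>
  have "contractions \<subseteq> {p. N p \<le> N (1, 0)} \<times> {p. N p \<le> N (0, 1)}"
  proof
    fix M assume "M \<in> contractions"
    then have "N (mat_app M (1, 0)) \<le> N (1, 0)" "N (mat_app M (0, 1)) \<le> N (0, 1)"
      unfolding contractions_def by blast+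
    then show "M \<in> {p. N p \<le> N (1, 0)} \<times> {p. N p \<le> N (0, 1)}"
      by (cases M) (simp add: mat_app_def flip: zero_prod_def)
  qed
  moreover have "compact ({p. N p \<le> N (1, 0)} \<times> {p. N p \<le> N (0, 1)})"
    by (intro compact_Times compact_N_le)
  moreover have "closed contractions"
    unfolding contractions_def mat_app_def
    by (intro closed_Collect_all closed_Collect_le continuous_intros)
  ultimately show ?thesis
    using bounded_subset compact_eq_bounded_closed by blast
qed

lemma convex_contractions: "convex contractions"
proof -
  have "convex ((\<lambda>M. mat_app M p) -` {q. N q \<le> r})" for p r
    by (intro convex_linear_vimage convex_N_le linearI)
      (simp_all add: mat_app_add_left mat_app_scaleR_left)
  then have "convex (\<Inter>p. (\<lambda>M. mat_app M p) -` {q. N q \<le> N p})"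
    by (intro convex_INT) auto
  moreover have "contractions = (\<Inter>p. (\<lambda>M. mat_app M p) -` {q. N q \<le> N p})"
    by (auto simp: contractions_def)
  ultimately show ?thesis by simp
qed

section \<open>The inscribed form of maximal determinant\<close>

text \<open>The sublevel set of such a form at 1 contains the unit ball of \<open>N\<close>. For
  definite forms it is an ellipse whose area decreases as the determinant grows, so maximizing the
  determinant yields the Loewner ellipse.\<close>

definition "subforms = {t. \<forall>p. 0 \<le> quad_form t p \<and> quad_form t p \<le> (N p)\<^sup>2}"

lemma compact_subforms: "compact subforms"
proof -
  define A where "A = (N (1, 0))\<^sup>2"
  define C where "C = (N (0, 1))\<^sup>2"
  \<comment> \<open>The values at the basis vectors bound \<open>a\<close> and \<open>c\<close>.
    Nonnegativity at \<open>(1, 1)\<close> and \<open>(1, -1)\<close> gives that twice the absolute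
    value of \<open>b\<close> is at most \<open>a + c\<close>.\<close>
  have "t \<in> {0..A} \<times> {-(A+C)..A+C} \<times> {0..C}" if "t \<in> subforms" for t
  proof -
    obtain a b c where t: "t = (a, b, c)" by (cases t) auto
    have q: "0 \<le> quad_form t p \<and> quad_form t p \<le> (N p)\<^sup>2" for p
      using that by (auto simp: subforms_def)
    show ?thesis
      using q[of "(1,0)"] q[of "(0,1)"] q[of "(1,1)"] q[of "(1,-1)"]
      by (simp add: t quad_form_def A_def C_def)
  qed
  then have "subforms \<subseteq> {0..A} \<times> {-(A+C)..A+C} \<times> {0..C}" by blast
  moreover have "compact ({0..A} \<times> {-(A+C)..A+C} \<times> {0..C})"
    by (intro compact_Times compact_Icc)
  moreover have "closed subforms"
    unfolding subforms_def quad_form_def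
    by (intro closed_Collect_all closed_Collect_conj closed_Collect_le continuous_intros)
  ultimately show ?thesis
    using bounded_subset compact_eq_bounded_closed by blast
qed

lemma subform_maximal_det:
  obtains t where "t \<in> subforms" "0 < form_det t" "\<And>s. s \<in> subforms \<Longrightarrow> form_det s \<le> form_det t"
proof -
  obtain m where m: "0 < m" "\<And>p. m * norm p \<le> N p" using N_lower_bound by blast
  \<comment> \<open>A multiple of the Euclidean form lies below the squared norm, which makes the
    maximal determinant positive.\<close>
  define s where "s = (m\<^sup>2, 0::real, m\<^sup>2)"
  have "quad_form s p = (m * norm p)\<^sup>2" for p
    by (cases p) (simp add: s_def quad_form_def norm_Pair power_mult_distrib algebra_simps)
  then have s: "s \<in> subforms" using m unfolding subforms_def
    by (auto intro!: power_mono)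
  have "continuous_on subforms form_det"
    unfolding form_det_def by (intro continuous_intros)
  then obtain t where t: "t \<in> subforms" "\<And>s. s \<in> subforms \<Longrightarrow> form_det s \<le> form_det t"
    using continuous_attains_sup[OF compact_subforms] s by blast
  have "0 < form_det s" using m by (simp add: s_def form_det_def)
  with t(2)[OF s] have "0 < form_det t" by linarith
  with t that show ?thesis by blast
qed

lemma form_pullback_subforms:
  assumes "t \<in> subforms" "M \<in> contractions"
  shows "form_pullback t M \<in> subforms"
proof -
  have "0 \<le> quad_form t (mat_app M p) \<and> quad_form t (mat_app M p) \<le> (N p)\<^sup>2" for p
  proof -
    have "(N (mat_app M p))\<^sup>2 \<le> (N p)\<^sup>2"
      using assms(2) by (intro power_mono) (auto simp: contractions_def)
    then show ?thesis
      using assms(1) order_trans unfolding subforms_def by blast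
  qed
  then show ?thesis by (simp add: subforms_def quad_form_pullback)
qed

lemma subform_fst_pos: 
  assumes "t \<in> subforms" "0 < form_det t"
  shows "0 < fst t"
proof -
  have "0 \<le> quad_form t (1, 0)" using assms unfolding subforms_def by blast
  then have "0 \<le> fst t" by (simp add: quad_form_def)
  moreover have "fst t \<noteq> 0" using assms(2) by (auto simp: form_det_def)
  ultimately show ?thesis by simp
qed

text \<open>Pulling back by a contraction multiplies the determinant of \<open>t\<close> by the
  squared determinant of the matrix, which by maximality is at most 1. This is applied to
  \<open>M\<close> and to its inverse.\<close>

lemma isometry_det:
  assumes iso: "\<And>p. N (mat_app M p) = N p" and t: "t \<in> subforms" "0 < form_det t"
    and max: "\<And>s. s \<in> subforms \<Longrightarrow> form_det s \<le> form_det t"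
  shows "(mat_det M)\<^sup>2 = 1"
proof -
  have le: "(mat_det K)\<^sup>2 \<le> 1" if "K \<in> contractions" for K
    using max[OF form_pullback_subforms[OF t(1) that]] t(2) by (simp add: form_det_pullback)
  obtain a c b d where M: "M = ((a, c), (b, d))" by (metis prod.collapse)
  define D where "D = mat_det M"
  have D: "D = a * d - b * c" by (simp add: D_def M mat_det_def)
  have ker: "p = 0" if "mat_app M p = 0" for p
    using iso[of p] that by (metis N_eq_0)
  \<comment> \<open>If \<open>D = 0\<close>, the columns of the adjugate lie in the trivial kernel
    of \<open>M\<close>. Then all entries of \<open>M\<close> vanish, which is absurd.\<close>
  have "D \<noteq> 0"
  proof
    assume "D = 0"
    then have "mat_app M (d, -c) = 0" "mat_app M (-b, a) = 0"
      by (simp_all add: M mat_app_def D algebra_simps zero_prod_def)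
    then have "(d, -c) = 0" "(-b, a) = 0" using ker by blast+
    then have "mat_app M (1, 0) = 0" by (simp add: M mat_app_def zero_prod_def)
    then have "(1, 0) = (0 :: real \<times> real)" by (rule ker)
    then show False by (simp add: zero_prod_def)
  qed
  \<comment> \<open>The adjugate divided by the determinant, that is, the inverse of
    \<open>M\<close>.\<close>
  define K where "K = ((d / D, - c / D), (- b / D, a / D))"
  have "mat_app M (mat_app K p) = p" for p
  proof -
    obtain x y where p: "p = (x, y)" by (cases p)
    have "mat_app K p = (1 / D) *\<^sub>R (d * x - b * y, a * y - c * x)"
      by (simp add: p K_def mat_app_def diff_divide_distrib algebra_simps)
    moreover have "mat_app M (d * x - b * y, a * y - c * x) = D *\<^sub>R p"
      by (simp add: p M mat_app_def D algebra_simps)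
    ultimately show ?thesis
      using \<open>D \<noteq> 0\<close> by (simp only: linear_scale[OF linear_mat_app]) simp
  qed
  then have "N (mat_app K p) = N p" for p using iso[of "mat_app K p"] by simp
  then have "K \<in> contractions" by (simp add: contractions_def)
  from le[OF this] have "(mat_det K)\<^sup>2 \<le> 1" .
  moreover have "mat_det K = 1 / D"
  proof -
    have "mat_det K = (a * d - b * c) / D\<^sup>2" by (simp add: K_def mat_det_def power2_eq_square diff_divide_distrib algebra_simps)
    then show ?thesis using \<open>D \<noteq> 0\<close> by (simp flip: D add: power2_eq_square)
  qed
  ultimately have "1 \<le> D\<^sup>2" using \<open>D \<noteq> 0\<close> by (simp add: power_divide field_simps)
  moreover have "D\<^sup>2 \<le> 1" unfolding D_def using iso by (intro le) (simp add: contractions_def)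
  ultimately show ?thesis by (simp add: D_def)
qed

text \<open>The pullback of \<open>t\<close> is again a subform of maximal determinant, and so is no
  better than the midpoint with \<open>t\<close> allows: strict log-concavity forces the two to
  coincide.\<close>

lemma isometry_preserves_maximal_form:
  assumes iso: "\<And>p. N (mat_app M p) = N p" and t: "t \<in> subforms" "0 < form_det t"
    and max: "\<And>s. s \<in> subforms \<Longrightarrow> form_det s \<le> form_det t"
  shows "quad_form t (mat_app M p) = quad_form t p"
proof -
  have "M \<in> contractions" using iso by (simp add: contractions_def)
  then have s: "form_pullback t M \<in> subforms" by (rule form_pullback_subforms[OF t(1)])
  have det: "form_det (form_pullback t M) = form_det t"
    using isometry_det[OF assms] by (simp add: form_det_pullback)
  have "(1/2) *\<^sub>R (form_pullback t M + t) \<in> subforms"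
    using s t(1) unfolding subforms_def
    by (simp add: quad_form_scaleR_form quad_form_add_form) (smt (verit))
  then have "form_pullback t M = t"
    by (intro form_det_midpoint[OF det refl t(2)] subform_fst_pos max s t) (simp add: det t)
  then show ?thesis by (metis quad_form_pullback)
qed

text \<open>Let \<open>r\<close> be the maximum of the form on the unit sphere of \<open>N\<close>.
  If \<open>r < 1\<close>, there is room to enlarge \<open>t\<close> by a factor above 1, which
  would raise the determinant.\<close>

lemma maximal_form_contact:
  assumes t: "t \<in> subforms" "0 < form_det t"
    and max: "\<And>s. s \<in> subforms \<Longrightarrow> form_det s \<le> form_det t"
  obtains y where "N y = 1" "quad_form t y = 1"
proof -
  have "compact ({p. N p \<le> 1} \<inter> {p. N p = 1})"
    by (intro compact_Int_closed compact_N_le closed_Collect_eq continuous_intros)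
  also have "{p. N p \<le> 1} \<inter> {p. N p = 1} = {p. N p = 1}" by auto
  finally have "compact {p. N p = 1}" .
  moreover have "N ((1 / N (1, 0)) *\<^sub>R (1, 0)) = 1"
    unfolding N_scaleR by (simp add: zero_prod_def)
  then have "{p. N p = 1} \<noteq> {}" by blast
  moreover have "continuous_on {p. N p = 1} (quad_form t)"
    unfolding quad_form_def by (intro continuous_intros)
  ultimately obtain y where y: "N y = 1" "\<And>p. N p = 1 \<Longrightarrow> quad_form t p \<le> quad_form t y"
    by (metis (mono_tags, lifting) continuous_attains_sup mem_Collect_eq)
  define r where "r = quad_form t y"
  have r: "0 \<le> r" "r \<le> 1" using t(1) y(1) unfolding r_def subforms_def by (auto, metis power_one)
  have bd: "quad_form t p \<le> r * (N p)\<^sup>2" for p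
  proof (cases "p = 0")
    case False
    then have pos: "0 < N p" by (metis N_eq_0 N_ge_0 order_less_le)
    have "quad_form t ((1 / N p) *\<^sub>R p) \<le> r"
      unfolding r_def using pos by (intro y(2)) (simp add: N_scaleR del: N_eq_0)
    then show ?thesis using pos by (simp add: quad_form_scaleR power_divide pos_divide_le_eq del: N_eq_0)
  qed (simp add: quad_form_def)
  have "r = 1"
  proof (rule ccontr)
    assume "r \<noteq> 1"
    with r have "r < 1" by simp
    \<comment> \<open>Scaling by \<open>2 - r\<close> instead of \<open>1 / r\<close> avoids the case \<open>r = 0\<close>.\<close>
    have "(2 - r) * r \<le> 1" using zero_le_power2[of "1 - r"] by (simp add: power2_eq_square algebra_simps)
    then have "(2 - r) * quad_form t p \<le> (N p)\<^sup>2" for p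
    proof -
      have "(2 - r) * quad_form t p \<le> (2 - r) * (r * (N p)\<^sup>2)"
        using r by (intro mult_left_mono bd) auto
      also have "\<dots> = ((2 - r) * r) * (N p)\<^sup>2" by simp
      also have "\<dots> \<le> 1 * (N p)\<^sup>2"
        using \<open>(2 - r) * r \<le> 1\<close> by (intro mult_right_mono) auto
      finally show ?thesis by simp
    qed
    then have "(2 - r) *\<^sub>R t \<in> subforms"
      using t(1) r unfolding subforms_def by (simp add: quad_form_scaleR_form)
    from max[OF this] have "(2 - r)\<^sup>2 * form_det t \<le> 1 * form_det t"
      by (simp add: form_det_scaleR)
    then have "(2 - r)\<^sup>2 \<le> 1" using t(2) by (simp only: mult_le_cancel_right_pos)
    moreover have "1 < (2 - r)\<^sup>2" using \<open>r < 1\<close> by (intro one_less_power) auto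
    ultimately show False by simp
  qed
  with y(1) that show ?thesis unfolding r_def by blast
qed

lemma quadratic_if_extreme_isometries:
  assumes ext: "\<And>M p. M extreme_point_of contractions \<Longrightarrow> N (mat_app M p) = N p"
  shows "\<exists>t. \<forall>p. (N p)\<^sup>2 = quad_form t p"
proof -
  obtain t where t: "t \<in> subforms" "0 < form_det t"
    and max: "\<And>s. s \<in> subforms \<Longrightarrow> form_det s \<le> form_det t"
    by (rule subform_maximal_det) blast
  obtain y where y: "N y = 1" "quad_form t y = 1" by (rule maximal_form_contact[OF t max])
  have nonneg: "0 \<le> quad_form t p" for p using t(1) by (simp add: subforms_def)
  \<comment> \<open>\<open>S\<close> collects the contractions for the seminorm given by
    \<open>t\<close>. Being convex and containing the extreme contractions of \<open>N\<close>, it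
    contains their convex hull.\<close>
  define S where "S = {M. \<forall>p. quad_form t (mat_app M p) \<le> quad_form t p}"
  have "convex S"
  proof (rule convexI)
    fix A B and u v :: real assume *: "A \<in> S" "B \<in> S" "0 \<le> u" "0 \<le> v" "u + v = 1"
    have "quad_form t (mat_app (u *\<^sub>R A + v *\<^sub>R B) p) \<le> quad_form t p" for p
    proof -
      have "quad_form t (mat_app (u *\<^sub>R A + v *\<^sub>R B) p)
          \<le> u * quad_form t (mat_app A p) + v * quad_form t (mat_app B p)"
        unfolding mat_app_add_left mat_app_scaleR_left using * by (intro quad_form_convex nonneg)
      also have "\<dots> \<le> u * quad_form t p + v * quad_form t p"
        using * unfolding S_def by (intro add_mono mult_left_mono) auto
      also have "\<dots> = quad_form t p" using * by (simp flip: distrib_right)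
      finally show ?thesis .
    qed
    then show "u *\<^sub>R A + v *\<^sub>R B \<in> S" by (simp add: S_def)
  qed
  moreover have "{M. M extreme_point_of contractions} \<subseteq> S"
    using isometry_preserves_maximal_form[OF ext t max] by (auto simp: S_def)
  ultimately have "contractions \<subseteq> S"
    using Krein_Milman_Minkowski[OF compact_contractions convex_contractions]
    by (metis hull_minimal)
  have "(N x)\<^sup>2 \<le> quad_form t x" for x
  proof (rule ccontr)
    assume "\<not> (N x)\<^sup>2 \<le> quad_form t x"
    \<comment> \<open>Dividing by the square root of a value strictly between the two gives a point
      \<open>z\<close> outside the unit ball of \<open>N\<close> at which the form is still below
      1.\<close>
    then obtain r where r: "quad_form t x < r" "r < (N x)\<^sup>2"
      using dense by (metis not_le)
    then have "0 < r" using nonneg[of x] by simp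
    define z where "z = (1 / sqrt r) *\<^sub>R x"
    have "quad_form t z < 1" using r \<open>0 < r\<close> by (simp add: z_def quad_form_scaleR power_divide)
    have "sqrt r < N x" using r \<open>0 < r\<close> by (simp add: real_less_lsqrt)
    then have "1 < N z" using \<open>0 < r\<close> by (simp add: z_def N_scaleR)
    then have "z \<notin> {p. N p \<le> 1}" by simp
    \<comment> \<open>Separation of \<open>z\<close> from the unit ball provides a functional of
      norm at most one that exceeds 1 at \<open>z\<close>.\<close>
    then obtain a b where ab: "a \<bullet> z < b" "\<And>p. N p \<le> 1 \<Longrightarrow> b < a \<bullet> p"
      using separating_hyperplane_closed_point[OF convex_N_le[of 1]]
        compact_imp_closed[OF compact_N_le[of 1]] by blast
    have "b < 0" using ab(2)[of 0] by simp
    \<comment> \<open>Since the unit ball contains 0, \<open>b\<close> is negative. Division by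
      \<open>b\<close> reverses both inequalities, giving \<open>f < 1\<close> on the ball and
      \<open>1 < f z\<close>.\<close>
    define f where "f p = (a \<bullet> p) / b" for p
    have f_lin: "linear f" unfolding f_def
      by (rule linearI) (simp_all add: inner_add_right add_divide_distrib)
    have "1 < f z" using ab(1) \<open>b < 0\<close> by (simp add: f_def field_simps)
    have le1: "\<bar>f p\<bar> \<le> 1" if "N p \<le> 1" for p
    proof -
      have "N (- p) \<le> 1" using N_scaleR[of "-1" p] that by simp
      with ab(2)[of p] ab(2)[of "-p"] that \<open>b < 0\<close> show ?thesis
        by (simp add: f_def abs_le_iff field_simps)
    qed
    have f_le: "\<bar>f p\<bar> \<le> N p" for p
    proof (cases "p = 0")
      case False
      then have pos: "0 < N p" by (metis N_eq_0 N_ge_0 order_less_le)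
      have "\<bar>f ((1 / N p) *\<^sub>R p)\<bar> \<le> 1" using pos by (intro le1) (simp add: N_scaleR)
      then show ?thesis using pos by (simp add: linear_scale[OF f_lin] abs_mult field_simps)
    qed (simp add: f_def)
    define g where "g p = f p *\<^sub>R y" for p
    have "linear g" unfolding g_def
      by (rule linearI) (simp_all add: linear_add[OF f_lin] linear_scale[OF f_lin] scaleR_add_left)
    then have app: "mat_app (g (1, 0), g (0, 1)) p = f p *\<^sub>R y" for p
      using mat_app_of_linear[of g p] by (simp add: g_def)
    \<comment> \<open>The rank one map into the line of \<open>y\<close> contracts because
      \<open>N y = 1\<close>. At \<open>z\<close> the form takes the value
      \<open>(f z)\<^sup>2\<close> on its image, because \<open>y\<close> is a contact
      point.\<close>
    have "(g (1, 0), g (0, 1)) \<in> contractions"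
      using f_le by (simp add: contractions_def app N_scaleR y)
    then have "quad_form t (f z *\<^sub>R y) \<le> quad_form t z"
      using \<open>contractions \<subseteq> S\<close> by (auto simp: S_def simp flip: app)
    then have "(f z)\<^sup>2 < 1" using \<open>quad_form t z < 1\<close> by (simp add: quad_form_scaleR y)
    moreover have "1 < (f z)\<^sup>2" using \<open>1 < f z\<close> by (intro one_less_power) auto
    ultimately show False by simp
  qed
  then have "(N p)\<^sup>2 = quad_form t p" for p
    using t(1) unfolding subforms_def by (simp add: order_antisym)
  then show ?thesis by blast
qed

section \<open>Operators on the plane as matrices\<close>

text \<open>The value 0 off the plane follows the convention of \<open>bounded_operators_on\<close>,
  so that every operator on the plane is reached.\<close>

definition "extend M = (\<lambda>x. if x \<in> range L then L (mat_app M (inv L x)) else 0)"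

lemma extend_L [simp]: "extend M (L p) = L (mat_app M p)"
  by (simp add: extend_def inv_f_f[OF inj_L])

lemma linear_extend: "linear extend"
  by (rule linearI)
    (simp_all add: extend_def fun_eq_iff scaleR_fun_def mat_app_add_left mat_app_scaleR_left
      linear_add[OF linear_L] linear_scale[OF linear_L])

lemma inj_extend: "inj extend"
proof (rule injI)
  fix M M' assume "extend M = extend M'"
  then have "L (mat_app M p) = L (mat_app M' p)" for p by (metis extend_L)
  then show "M = M'" by (intro mat_app_inject injD[OF inj_L])
qed

lemma subspace_range_L: "subspace (range L)"
  using linear_L linear_subspace_image subspace_UNIV by blast

lemma extend_bounded_operators: "extend M \<in> bounded_operators_on (range L)"
proof -
  have add: "extend M (x + y) = extend M x + extend M y"
    if "x \<in> range L" "y \<in> range L" for x y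
  proof -
    obtain p q where "x = L p" "y = L q" using \<open>x \<in> range L\<close> \<open>y \<in> range L\<close> by blast
    then show ?thesis
      using extend_L[of M "p + q"]
      by (simp add: linear_add[OF linear_L] linear_add[OF linear_mat_app])
  qed
  have scale: "extend M (c *\<^sub>R x) = c *\<^sub>R extend M x" if "x \<in> range L" for c x
  proof -
    obtain p where "x = L p" using \<open>x \<in> range L\<close> by blast
    then show ?thesis
      using extend_L[of M "c *\<^sub>R p"]
      by (simp add: linear_scale[OF linear_L] linear_scale[OF linear_mat_app])
  qed
  \<comment> \<open>The constant \<open>m\<close> converts a bound relative to the Euclidean norm of
    the coordinates into one relative to the norm of the ambient space.\<close>
  obtain m where m: "0 < m" "\<And>p. m * norm p \<le> N p" using N_lower_bound by blast
  have "linear (\<lambda>p. L (mat_app M p))"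
    using linear_compose[OF linear_mat_app linear_L] by (simp add: o_def)
  then obtain K where K: "0 < K" "\<And>p. norm (L (mat_app M p)) \<le> K * norm p"
    using linear_bounded_pos by blast
  have "norm (extend M x) \<le> K / m * norm x" if "x \<in> range L" for x
  proof -
    obtain p where x: "x = L p" using \<open>x \<in> range L\<close> by blast
    have "norm p \<le> norm x / m"
      using m by (simp add: x pos_le_divide_eq mult.commute flip: N_def)
    then have "K * norm p \<le> K * (norm x / m)" using K(1) by (intro mult_left_mono) auto
    with K(2)[of p] show ?thesis by (simp add: x)
  qed
  moreover have "extend M x \<in> range L" if "x \<in> range L" for x
    using that by auto
  moreover have "extend M x = 0" if "x \<notin> range L" for x
    using that by (simp add: extend_def)
  ultimately show ?thesis
    unfolding bounded_operators_on_def using add scale by blast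
qed

text \<open>Conjugating \<open>T\<close> with the chart gives a linear map \<open>g\<close> of
  coordinates, whose matrix is \<open>M\<close>. Off the plane both sides vanish.\<close>

lemma bounded_operators_eq_extend:
  assumes "T \<in> bounded_operators_on (range L)"
  obtains M where "T = extend M"
proof -
  have T: "\<And>x. x \<in> range L \<Longrightarrow> T x \<in> range L"
    "\<And>x y. x \<in> range L \<Longrightarrow> y \<in> range L \<Longrightarrow> T (x + y) = T x + T y"
    "\<And>c x. x \<in> range L \<Longrightarrow> T (c *\<^sub>R x) = c *\<^sub>R T x"
    "\<And>x. x \<notin> range L \<Longrightarrow> T x = 0"
    using assms unfolding bounded_operators_on_def by blast+
  define g where "g p = inv L (T (L p))" for p
  have Lg: "L (g p) = T (L p)" for p
    using T(1)[of "L p"] by (simp add: g_def f_inv_into_f)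
  have "linear g"
  proof (rule linearI)
    show "g (p + q) = g p + g q" for p q
      by (rule injD[OF inj_L]) (simp add: Lg linear_add[OF linear_L] T)
    show "g (c *\<^sub>R p) = c *\<^sub>R g p" for c p
      by (rule injD[OF inj_L]) (simp add: Lg linear_scale[OF linear_L] T)
  qed
  then have "T x = extend (g (1, 0), g (0, 1)) x" for x
  proof (cases "x \<in> range L")
    case True
    then obtain p where "x = L p" by blast
    with \<open>linear g\<close> show ?thesis by (simp add: mat_app_of_linear Lg)
  next
    case False
    then show ?thesis by (simp add: T(4) extend_def)
  qed
  then show ?thesis using that by blast
qed

lemma extend_image_contractions: "extend ` contractions = operator_unit_ball (range L)"
proof -
  have "M \<in> contractions \<longleftrightarrow> extend M \<in> operator_unit_ball (range L)" for M
    by (simp add: operator_unit_ball_iff[OF subspace_range_L] extend_bounded_operators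
        contractions_def N_def)
  moreover have "\<exists>M. T = extend M" if "T \<in> operator_unit_ball (range L)" for T
    using that bounded_operators_eq_extend
    unfolding operator_unit_ball_iff[OF subspace_range_L] by blast
  ultimately show ?thesis by blast
qed

text \<open>The linear injection \<open>extend\<close> carries \<open>contractions\<close> onto the
  operator unit ball, hence extreme points onto extreme points.\<close>

lemma extreme_isometries_iff:
  "(\<forall>T. extreme_contraction_on (range L) T \<longrightarrow> linear_isometry_on (range L) T) \<longleftrightarrow>
   (\<forall>M. M extreme_point_of contractions \<longrightarrow> (\<forall>p. N (mat_app M p) = N p))"
proof -
  have ext: "extreme_contraction_on (range L) T \<longleftrightarrow>
      (\<exists>M. T = extend M \<and> M extreme_point_of contractions)" for T
  proof -
    have "extreme_contraction_on (range L) T \<longleftrightarrow> T extreme_point_of operator_unit_ball (range L)"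
      unfolding extreme_contraction_on_def extreme_point_of_def operator_unit_ball_def by blast
    then show ?thesis
      unfolding extend_image_contractions[symmetric]
      using extreme_point_of_linear_image[OF linear_extend inj_extend]
      by (metis (no_types, lifting) extreme_point_of_def imageE)
  qed
  have "linear_isometry_on (range L) (extend M) \<longleftrightarrow> (\<forall>p. N (mat_app M p) = N p)" for M
    by (simp add: linear_isometry_on_def extend_bounded_operators N_def)
  with ext show ?thesis by auto
qed

section \<open>Extreme contractions of the Euclidean plane\<close>

text \<open>A singular value argument: \<open>M\<close> attains its norm at \<open>v\<close>, and
  extremality forces first \<open>a = M v\<close> and then the image \<open>b\<close> of the
  perpendicular vector to have length 1. As \<open>a\<close> and \<open>b\<close> are orthogonal,
  \<open>M\<close> is an isometry.\<close>

lemma extreme_isometry_if_euclidean: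
  assumes N: "\<And>p. N p = norm p" and M: "M extreme_point_of contractions"
  shows "N (mat_app M p) = N p"
proof -
  have in_contr: "K \<in> contractions \<longleftrightarrow> (\<forall>p. norm (mat_app K p) \<le> norm p)" for K
    by (simp add: contractions_def N)
  have le: "norm (mat_app M p) \<le> norm p" for p
    using M in_contr by (simp add: extreme_point_of_def)
  define rot :: "real \<times> real \<Rightarrow> real \<times> real" where "rot q = (- snd q, fst q)" for q
  have rot: "norm (rot q) = norm q" "q \<bullet> rot q = 0" for q
    by (simp_all add: rot_def norm_prod_def inner_prod_def)
  have lin: "linear (mat_app M)" by (rule linear_mat_app)
  have "continuous_on (sphere 0 1) (\<lambda>p. norm (mat_app M p))"
    unfolding mat_app_def by (intro continuous_intros)
  moreover have "compact (sphere 0 1 :: (real \<times> real) set)"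
      "(sphere 0 1 :: (real \<times> real) set) \<noteq> {}"
    by auto
  ultimately have "\<exists>v\<in>sphere 0 1. \<forall>p\<in>sphere 0 1. norm (mat_app M p) \<le> norm (mat_app M v)"
    by (intro continuous_attains_sup)
  then have "\<exists>v. norm v = 1 \<and> (\<forall>p. norm p = 1 \<longrightarrow> norm (mat_app M p) \<le> norm (mat_app M v))"
    by (simp only: Bex_def Ball_def mem_sphere_0)
  then obtain v where v: "norm v = 1"
    and vmax: "\<And>p. norm p = 1 \<Longrightarrow> norm (mat_app M p) \<le> norm (mat_app M v)"
    by blast
  define a where "a = mat_app M v"
  define b where "b = mat_app M (rot v)"
  have a1: "norm a = 1"
  proof (rule ccontr)
    assume "norm a \<noteq> 1"
    with le[of v] v have lt: "norm a < 1" by (simp add: a_def)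
    have bd: "norm (mat_app M p) \<le> norm a * norm p" for p
    proof (cases "p = 0")
      case False
      then have "norm (mat_app M ((1 / norm p) *\<^sub>R p)) \<le> norm a"
        unfolding a_def by (intro vmax) simp
      then show ?thesis using False by (simp add: linear_scale[OF lin] field_simps)
    qed (simp add: mat_app_def)
    \<comment> \<open>If the norm of \<open>M\<close> is below 1, a multiple of the identity fits
      into the remaining slack.\<close>
    define D where "D = (1 - norm a) *\<^sub>R ((1::real, 0::real), (0::real, 1::real))"
    have D: "mat_app D p = (1 - norm a) *\<^sub>R p" for p
      by (cases p) (simp add: D_def mat_app_def)
    have "norm (mat_app (M + D) p) \<le> norm p \<and> norm (mat_app (M - D) p) \<le> norm p" for p
    proof -
      have "norm (mat_app D p) = (1 - norm a) * norm p" using lt by (simp add: D)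
      then have "norm (mat_app M p) + norm (mat_app D p) \<le> norm p"
        using bd[of p] by (simp add: algebra_simps)
      then show ?thesis
        using norm_triangle_ineq[of "mat_app M p" "mat_app D p"]
          norm_triangle_ineq4[of "mat_app M p" "mat_app D p"]
        by (simp add: mat_app_add_left mat_app_diff_left)
    qed
    then have "D = 0" by (intro extreme_point_perturbation[OF M]) (simp_all add: in_contr)
    then show False using lt by (simp add: D_def zero_prod_def)
  qed
  have decomp: "p = (p \<bullet> v) *\<^sub>R v + (p \<bullet> rot v) *\<^sub>R rot v" for p
  proof -
    obtain v1 v2 p1 p2 where vp: "v = (v1, v2)" "p = (p1, p2)" by (metis prod.collapse)
    have "v1\<^sup>2 + v2\<^sup>2 = 1" using v by (simp add: vp norm_Pair)
    then have "p1 = p1 * (v1\<^sup>2 + v2\<^sup>2)" "p2 = p2 * (v1\<^sup>2 + v2\<^sup>2)" by simp_all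
    then show ?thesis by (simp add: vp rot_def power2_eq_square algebra_simps)
  qed
  have norm_p: "(norm (x *\<^sub>R v + y *\<^sub>R rot v))\<^sup>2 = x\<^sup>2 + y\<^sup>2" for x y
    by (subst norm_orthogonal_combination) (simp_all add: rot v)
  have app: "mat_app M (x *\<^sub>R v + y *\<^sub>R rot v) = x *\<^sub>R a + y *\<^sub>R b" for x y
    by (simp add: a_def b_def linear_add[OF lin] linear_scale[OF lin])
  have ab: "a \<bullet> b = 0"
  proof -
    \<comment> \<open>Contractivity at \<open>v + k * rot v\<close> with this \<open>k\<close> gives
      \<open>1 + 2 * k\<^sup>2 + k\<^sup>2 * (norm b)\<^sup>2 \<le> 1 + k\<^sup>2\<close>, which
      leaves only \<open>k = 0\<close>.\<close>
    define k where "k = a \<bullet> b"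
    have "(norm (1 *\<^sub>R a + k *\<^sub>R b))\<^sup>2 \<le> 1\<^sup>2 + k\<^sup>2"
      unfolding app[symmetric] norm_p[symmetric] by (intro power_mono le) simp
    moreover have "(norm (1 *\<^sub>R a + k *\<^sub>R b))\<^sup>2
        = (norm a)\<^sup>2 + 2 * k * (a \<bullet> b) + k\<^sup>2 * (norm b)\<^sup>2"
      by (simp only: power2_norm_eq_inner inner_add_left inner_add_right inner_scaleR_left
          inner_scaleR_right inner_commute[of b a]) (simp add: power2_eq_square distrib_left)
    then have "(norm (1 *\<^sub>R a + k *\<^sub>R b))\<^sup>2 = 1 + 2 * k\<^sup>2 + k\<^sup>2 * (norm b)\<^sup>2"
      by (simp only: a1 flip: k_def) (simp add: power2_eq_square)
    ultimately have "k\<^sup>2 + (k * norm b)\<^sup>2 \<le> 0" by (simp add: power_mult_distrib)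
    then have "k\<^sup>2 = 0" by (smt (verit) zero_le_power2)
    then show ?thesis by (simp add: k_def)
  qed
  have b1: "norm b = 1"
  proof (rule ccontr)
    assume "norm b \<noteq> 1"
    with le[of "rot v"] v rot have lt: "norm b < 1" by (simp add: b_def)
    \<comment> \<open>This perturbation kills \<open>v\<close> and moves \<open>b\<close>
      orthogonally to \<open>a\<close> by its missing length. By Pythagoras both signs, encoded by
      \<open>e\<close> below, preserve contractivity.\<close>
    define g where "g p = ((1 - norm b) * (p \<bullet> rot v)) *\<^sub>R rot a" for p
    have "linear g" unfolding g_def
      by (rule linearI) (simp_all add: inner_add_left algebra_simps)
    define D where "D = (g (1, 0), g (0, 1))"
    have D: "mat_app D p = g p" for p using \<open>linear g\<close> by (simp add: D_def mat_app_of_linear)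
    have perp: "norm (x *\<^sub>R a + y *\<^sub>R (b + (e * (1 - norm b)) *\<^sub>R rot a)) \<le> norm (x *\<^sub>R v + y *\<^sub>R rot v)"
      if "\<bar>e\<bar> = 1" for x y e
    proof -
      have "norm (b + (e * (1 - norm b)) *\<^sub>R rot a) \<le> norm b + norm ((e * (1 - norm b)) *\<^sub>R rot a)"
        by (rule norm_triangle_ineq)
      also have "\<dots> = 1" using that lt by (simp add: rot a1 abs_mult)
      finally have "(norm (b + (e * (1 - norm b)) *\<^sub>R rot a))\<^sup>2 \<le> 1"
        by (simp add: power_le_one)
      then have "y\<^sup>2 * (norm (b + (e * (1 - norm b)) *\<^sub>R rot a))\<^sup>2 \<le> y\<^sup>2"
        by (simp add: mult_left_le)
      moreover have "(norm (x *\<^sub>R a + y *\<^sub>R (b + (e * (1 - norm b)) *\<^sub>R rot a)))\<^sup>2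
          = x\<^sup>2 * (norm a)\<^sup>2 + y\<^sup>2 * (norm (b + (e * (1 - norm b)) *\<^sub>R rot a))\<^sup>2"
        by (rule norm_orthogonal_combination) (simp add: inner_add_right ab rot)
      ultimately have "(norm (x *\<^sub>R a + y *\<^sub>R (b + (e * (1 - norm b)) *\<^sub>R rot a)))\<^sup>2
          \<le> (norm (x *\<^sub>R v + y *\<^sub>R rot v))\<^sup>2"
        by (simp add: norm_p a1)
      then show ?thesis by (rule power2_le_imp_le) simp
    qed
    have "norm (mat_app (M + D) p) \<le> norm p \<and> norm (mat_app (M - D) p) \<le> norm p" for p
    proof -
      define x y where "x = p \<bullet> v" and "y = p \<bullet> rot v"
      have p: "p = x *\<^sub>R v + y *\<^sub>R rot v" unfolding x_def y_def by (rule decomp)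
      have Mp: "mat_app M p = x *\<^sub>R a + y *\<^sub>R b" by (subst p) (rule app)
      have "mat_app (M + D) p = x *\<^sub>R a + y *\<^sub>R (b + (1 * (1 - norm b)) *\<^sub>R rot a)"
        "mat_app (M - D) p = x *\<^sub>R a + y *\<^sub>R (b + (-1 * (1 - norm b)) *\<^sub>R rot a)"
        by (simp_all add: mat_app_add_left mat_app_diff_left Mp D g_def algebra_simps flip: y_def)
      then show ?thesis using perp[of 1 x y] perp[of "-1" x y] p by simp
    qed
    then have "D = 0" by (intro extreme_point_perturbation[OF M]) (simp_all add: in_contr)
    then have "g (rot v) = 0" using D[of "rot v"] by (simp add: mat_app_def)
    moreover have "rot v \<bullet> rot v = 1" using rot(1)[of v] v by (simp add: norm_eq_1)
    ultimately have "rot a = 0" using lt by (simp add: g_def)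
    then show False using rot(1)[of a] a1 by simp
  qed
  have "(norm (mat_app M p))\<^sup>2 = (norm p)\<^sup>2"
    by (subst (1 2) decomp[of p])
      (simp only: app norm_p norm_orthogonal_combination[OF ab] a1 b1, simp)
  then show ?thesis by (simp add: N)
qed

end

section \<open>Norms induced by an inner product\<close>

text \<open>Gram-Schmidt for the form \<open>ip\<close>: coordinates with respect to the resulting
  orthonormal basis of \<open>Y\<close> are isometric to the Euclidean plane.\<close>

lemma orthonormal_chart:
  fixes ip :: "'a::real_normed_vector \<Rightarrow> 'a \<Rightarrow> real"
  assumes ip: "is_inner_product ip" and norm: "\<And>x. norm x = sqrt (ip x x)"
    and Y: "subspace Y" "dim Y = 2"
  obtains L :: "real \<times> real \<Rightarrow> 'a"
  where "linear L" "range L = Y" "\<And>p. norm (L p) = norm p"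
proof -
  have bil: "bilinear ip" and sym: "\<And>x y. ip x y = ip y x" and nonneg: "\<And>x. 0 \<le> ip x x"
    using ip unfolding is_inner_product_def by blast+
  note bil_simps = bilinear_ladd[OF bil] bilinear_radd[OF bil] bilinear_lmul[OF bil]
    bilinear_rmul[OF bil] bilinear_lsub[OF bil] bilinear_rsub[OF bil]
  have ip_norm: "ip x x = (norm x)\<^sup>2" for x using nonneg norm by simp
  obtain B where B: "B \<subseteq> Y" "independent B" "Y \<subseteq> span B" "card B = dim Y"
    by (rule basis_exists)
  obtain e f where ef: "B = {e, f}" "e \<noteq> f" using B(4) Y(2) by (auto simp: card_2_iff)
  have Yspan: "Y = span {e, f}"
    using B ef Y(1) by (simp add: span_minimal subset_antisym)
  have "e \<noteq> 0" using B(2) ef by (metis dependent_zero insertI1)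
  define u where "u = (1 / norm e) *\<^sub>R e"
  have u: "norm u = 1" "e = norm e *\<^sub>R u" using \<open>e \<noteq> 0\<close> by (simp_all add: u_def)
  define w where "w = f - ip f u *\<^sub>R u"
  have "f \<notin> span {e}" using B(2) ef by (metis dependent_def Diff_insert_absorb insertI1 insert_commute singleton_iff)
  then have "w \<noteq> 0" unfolding w_def u_def
    by (metis eq_iff_diff_eq_0 insertI1 span_base span_scale)
  define v where "v = (1 / norm w) *\<^sub>R w"
  have v: "norm v = 1" "w = norm w *\<^sub>R v" using \<open>w \<noteq> 0\<close> by (simp_all add: v_def)
  have uv: "ip u v = 0"
    by (simp add: v_def w_def bil_simps ip_norm u sym[of u f])
  define L where "L p = fst p *\<^sub>R u + snd p *\<^sub>R v" for p :: "real \<times> real"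
  have lin: "linear L" unfolding L_def by (rule linearI) (simp_all add: algebra_simps)
  have "(norm (L p))\<^sup>2 = (norm p)\<^sup>2" for p
  proof -
    have "ip (L p) (L p) = (fst p)\<^sup>2 + (snd p)\<^sup>2"
      by (simp only: L_def bil_simps)
        (simp add: ip_norm u(1) v(1) uv sym[of v u] power2_eq_square)
    then show ?thesis by (simp add: ip_norm norm_prod_def)
  qed
  then have isom: "norm (L p) = norm p" for p by simp
  have sub: "subspace (range L)" using lin linear_subspace_image subspace_UNIV by blast
  have "e = L (norm e, 0)" using u(2) by (simp add: L_def)
  moreover have "f = L (ip f u, norm w)" using v(2) by (simp add: L_def w_def)
  ultimately have "span {e, f} \<subseteq> range L" by (intro span_minimal sub) blast
  moreover have "u \<in> span {e, f}" unfolding u_def by (simp add: span_scale span_base)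
  then have "v \<in> span {e, f}"
    unfolding v_def w_def by (simp add: span_scale span_base span_diff)
  with \<open>u \<in> span {e, f}\<close> have "range L \<subseteq> span {e, f}"
    by (auto simp: L_def span_add span_scale)
  ultimately have "range L = Y" using Yspan by blast
  with lin isom that show ?thesis by blast
qed

text \<open>A variant of the Jordan-von Neumann theorem. Real homogeneity needs no continuity
  argument, because polarization returns the mixed coefficient of the form on each plane.\<close>

lemma inner_product_if_plane_quadratic:
  assumes quad: "\<And>(x :: 'a::real_normed_vector) (y :: 'a).
    \<exists>t. \<forall>p. (norm (fst p *\<^sub>R x + snd p *\<^sub>R y))\<^sup>2 = quad_form t p"
  shows "norm_from_inner_product TYPE('a)"
proof -
  define ip where "ip x y = ((norm (x + y))\<^sup>2 - (norm (x - y))\<^sup>2) / 4" for x y :: 'a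
  have sym: "ip x y = ip y x" for x y by (simp add: ip_def add.commute norm_minus_commute)
  have ip_self: "ip x x = (norm x)\<^sup>2" for x
  proof -
    have "x + x = 2 *\<^sub>R x" by (simp add: scaleR_2)
    then show ?thesis by (simp add: ip_def power_mult_distrib)
  qed
  have form: "\<exists>a b c. \<forall>s t. (norm (s *\<^sub>R x + t *\<^sub>R y))\<^sup>2 = a * s\<^sup>2 + 2 * b * s * t + c * t\<^sup>2" for x y :: 'a
    using quad[of x y] unfolding quad_form_def by (metis fst_conv snd_conv)
  have scale: "ip x (r *\<^sub>R y) = r * ip x y" for x y r
  proof -
    obtain a b c where *: "\<And>s t. (norm (s *\<^sub>R x + t *\<^sub>R y))\<^sup>2 = a * s\<^sup>2 + 2 * b * s * t + c * t\<^sup>2"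
      using form[of x y] by blast
    have "ip x (q *\<^sub>R y) = q * b" for q
      using *[of 1 q] *[of 1 "-q"] by (simp add: ip_def)
    from this[of r] this[of 1] show ?thesis by simp
  qed
  have parallelogram: "(norm (x + y))\<^sup>2 + (norm (x - y))\<^sup>2 = 2 * (norm x)\<^sup>2 + 2 * (norm y)\<^sup>2" for x y :: 'a
  proof -
    obtain a b c where *: "\<And>s t. (norm (s *\<^sub>R x + t *\<^sub>R y))\<^sup>2 = a * s\<^sup>2 + 2 * b * s * t + c * t\<^sup>2"
      using form[of x y] by blast
    show ?thesis
      using *[of 1 1] *[of 1 "-1"] *[of 1 0] *[of 0 1] by simp
  qed
  \<comment> \<open>Subtract the parallelogram law for \<open>x - z\<close> and \<open>y\<close>
    from the one for \<open>x + z\<close> and \<open>y\<close>.\<close>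
  have double: "ip (x + y) z + ip (x - y) z = 2 * ip x z" for x y z
    using parallelogram[of "x + z" y] parallelogram[of "x - z" y]
    by (simp add: ip_def algebra_simps diff_divide_distrib)
  have add: "ip (x + y) z = ip x z + ip y z" for x y z
  proof -
    have h: "2 * ip ((1/2) *\<^sub>R q) z = ip q z" for q
      using scale[of z "1/2" q] by (simp add: sym[of _ z])
    \<comment> \<open>Applied to half the sum and half the difference of \<open>x\<close> and
      \<open>y\<close>, the identity \<open>double\<close> becomes additivity.\<close>
    have eq: "(1/2) *\<^sub>R (x + y) + (1/2) *\<^sub>R (x - y) = x" "(1/2) *\<^sub>R (x + y) - (1/2) *\<^sub>R (x - y) = y"
      by (simp_all add: algebra_simps flip: scaleR_add_left)
    show ?thesis
      using double[of "(1/2) *\<^sub>R (x + y)" "(1/2) *\<^sub>R (x - y)" z] unfolding eq h by simp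
  qed
  have "bilinear ip"
    unfolding bilinear_def
  proof (intro conjI allI linearI)
    show "ip z (x + y) = ip z x + ip z y" for x y z using add[of x y z] by (simp only: sym[of z])
    show "ip (r *\<^sub>R x) y = r *\<^sub>R ip x y" for x y r using scale[of y r x] by (simp add: sym[of _ y])
  qed (simp_all add: add scale)
  then have "is_inner_product ip"
    unfolding is_inner_product_def using sym ip_self by auto
  then show ?thesis
    unfolding norm_from_inner_product_def using ip_self by (metis norm_ge_zero real_sqrt_abs abs_of_nonneg)
qed

section \<open>From planes to the whole space\<close>

theorem theorem2p7:
  shows "norm_from_inner_product TYPE('a::banach) \<longleftrightarrow>
    (\<forall>Y :: 'a set. subspace Y \<and> dim Y = 2 \<longrightarrow>
      (\<forall>T. extreme_contraction_on Y T \<longrightarrow> linear_isometry_on Y T))"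
proof
  assume "norm_from_inner_product TYPE('a)"
  then obtain ip :: "'a \<Rightarrow> 'a \<Rightarrow> real"
    where ip: "is_inner_product ip" "\<And>x. norm x = sqrt (ip x x)"
    unfolding norm_from_inner_product_def by (elim exE conjE) simp
  show "\<forall>Y :: 'a set. subspace Y \<and> dim Y = 2 \<longrightarrow>
      (\<forall>T. extreme_contraction_on Y T \<longrightarrow> linear_isometry_on Y T)"
  proof (intro allI impI, elim conjE)
    fix Y :: "'a set" and T
    assume Y: "subspace Y" "dim Y = 2" and T: "extreme_contraction_on Y T"
    obtain L :: "real \<times> real \<Rightarrow> 'a" where L: "linear L" "range L = Y" "\<And>p. norm (L p) = norm p"
      by (rule orthonormal_chart[OF ip Y]) blast
    have "inj L" unfolding linear_injective_0[OF L(1)] by (metis L(3) norm_eq_zero)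
    with L(1) interpret plane_chart L by (rule plane_chart.intro)
    have "N p = norm p" for p by (simp add: N_def L(3))
    then have "N (mat_app M p) = N p" if "M extreme_point_of contractions" for M p
      using that by (rule extreme_isometry_if_euclidean)
    then show "linear_isometry_on Y T"
      using T extreme_isometries_iff L(2) by blast
  qed
next
  assume ext: "\<forall>Y :: 'a set. subspace Y \<and> dim Y = 2 \<longrightarrow>
      (\<forall>T. extreme_contraction_on Y T \<longrightarrow> linear_isometry_on Y T)"
  show "norm_from_inner_product TYPE('a)"
  proof (rule inner_product_if_plane_quadratic)
    fix x y :: 'a
    show "\<exists>t. \<forall>p. (norm (fst p *\<^sub>R x + snd p *\<^sub>R y))\<^sup>2 = quad_form t p"
    \<comment> \<open>The hypothesis speaks only of genuine planes. The condition
      \<open>x \<noteq> y\<close> is needed because \<open>{x, x}\<close> is a singleton and may be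
      independent.\<close>
    proof (cases "x \<noteq> y \<and> independent {x, y}")
      case True
      then have xy: "x \<noteq> y" "y \<noteq> x" "independent {x, y}" by auto
      define L where "L p = fst p *\<^sub>R x + snd p *\<^sub>R y" for p :: "real \<times> real"
      have lin: "linear L" unfolding L_def by (rule linearI) (simp_all add: algebra_simps)
      have "p = 0" if "L p = 0" for p
      proof -
        \<comment> \<open>Independence concerns sums over a set, so the coefficients are indexed by
          the vectors themselves.\<close>
        have "(\<Sum>v\<in>{x, y}. (if v = x then fst p else snd p) *\<^sub>R v) = 0"
          using that xy(1,2) by (simp add: L_def)
        from independentD[OF xy(3) _ subset_refl this, of x]
          independentD[OF xy(3) _ subset_refl this, of y]
        have "fst p = 0" "snd p = 0" using xy(1,2) by simp_all
        then show ?thesis by (simp add: prod_eq_iff)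
      qed
      then have "inj L" using linear_injective_0[OF lin] by blast
      with lin interpret plane_chart L by (rule plane_chart.intro)
      have "range L = span {x, y}"
      proof
        show "range L \<subseteq> span {x, y}"
          unfolding L_def by (intro image_subsetI span_add span_scale span_base) auto
        have "x = L (1, 0)" "y = L (0, 1)" by (simp_all add: L_def)
        then show "span {x, y} \<subseteq> range L" by (intro span_minimal subspace_range_L) blast
      qed
      moreover have "dim (span {x, y}) = 2" using xy by (simp add: dim_eq_card_independent)
      ultimately have "\<forall>T. extreme_contraction_on (range L) T \<longrightarrow> linear_isometry_on (range L) T"
        using ext by simp
      then have "\<exists>t. \<forall>p. (N p)\<^sup>2 = quad_form t p"
        using extreme_isometries_iff by (intro quadratic_if_extreme_isometries) blast
      then show ?thesis by (simp add: N_def L_def)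
    next
      case False
      \<comment> \<open>Dependent vectors lie on one line, where the squared norm is the square of a
        linear form in the coefficients times a constant.\<close>
      have "\<exists>z u v. x = u *\<^sub>R z \<and> y = v *\<^sub>R z"
      proof (cases "x = 0")
        case True
        then have "x = 0 *\<^sub>R y \<and> y = 1 *\<^sub>R y" by simp
        then show ?thesis by blast
      next
        case x0: False
        have "y \<in> span {x}"
        proof (rule ccontr)
          assume "y \<notin> span {x}"
          moreover from this have "x \<noteq> y" using span_base by blast
          ultimately have "independent {x, y}"
            using x0 by (subst insert_commute) (simp add: independent_insert)
          with False \<open>x \<noteq> y\<close> show False by blast
        qed
        then obtain k where "y = k *\<^sub>R x" by (auto simp: span_singleton)
        moreover have "x = 1 *\<^sub>R x" by simp
        ultimately show ?thesis by blast
      qed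
      then obtain z u v where z: "x = u *\<^sub>R z" "y = v *\<^sub>R z" by blast
      have "(norm (fst p *\<^sub>R x + snd p *\<^sub>R y))\<^sup>2
          = quad_form (u\<^sup>2 * (norm z)\<^sup>2, u * v * (norm z)\<^sup>2, v\<^sup>2 * (norm z)\<^sup>2) p" for p
      proof -
        have "fst p *\<^sub>R x + snd p *\<^sub>R y = (fst p * u + snd p * v) *\<^sub>R z"
          by (simp add: z algebra_simps)
        then have "(norm (fst p *\<^sub>R x + snd p *\<^sub>R y))\<^sup>2 = (fst p * u + snd p * v)\<^sup>2 * (norm z)\<^sup>2"
          by (simp only: norm_scaleR power_mult_distrib power2_abs)
        then show ?thesis
          by (simp add: quad_form_def power_mult_distrib power2_sum algebra_simps)
      qed
      then show ?thesis by blast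
    qed
  qed
qed

end
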